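(* Let $\alpha>0$. Assume that the game mapping $F$ is single-valued and continuous. Then the operator $\mathcal R^\top\boldsymbol F$ is restricted monotone with respect to $\operatorname{zer}(\mathcal A_\alpha)$ if and only if, for every Nash equilibrium $x^\star=(x_i^\star,x_{-i}^\star)$ of the game and for all $i\in\mathcal I$, $\nabla_{x_i}f_i(x_i^\star,x_{-i})$ is independent of $x_{-i}\in\mathbb R^{n-n_i}$.
   Context: Game. $\mathcal I=\{1,\dots,N\}$ is a set of agents; agent $i$ has strategy $x_i\in\mathcal X_i\subseteq\mathbb R^{n_i}$; $n=\sum_i n_i$, $\mathcal X=\mathcal X_1\times\dots\times\mathcal X_N\subseteq\mathbb R^n$, $x=\operatorname{col}((x_i)_{i\in\mathcal I})$ (stacked vector), $x_{-i}=\operatorname{col}((x_j)_{j\ne i})$. Agent $i$ has cost $f_i:\mathbb R^n\to\mathbb R$, written $f_i(x_i,x_{-i})$. A Nash equilibrium is $x^\star\in\mathcal X$ with $x_i^\star\in\operatorname{argmin}_{y\in\mathcal X_i}f_i(y,x_{-i}^\star)$ for all $i$. Standing assumptions. (Convexity) For each $i$, $\mathcal X_i$ is nonempty, closed and convex; $f_i$ is continuous and $f_i(\cdot,x_{-i})$ is convex for every $x_{-i}$. (Existence) The game has at least one Nash equilibrium. (Connectivity) $\mathcal G(\mathcal I,\mathcal E)$ is an undirected connected graph with weight matrix $W\in\mathbb R^{N\times N}$, $w_{i,j}=[W]_{i,j}$, where for $i\ne j$, $w_{i,j}>0$ if $(i,j)\in\mathcal E$ and $w_{i,j}=0$ otherwise,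 and $W=W^\top$, $w_{i,i}>0$ for all $i$, $W\boldsymbol 1_N=\boldsymbol 1_N$, $\boldsymbol 1_N^\top W=\boldsymbol 1_N^\top$. Operators. $\partial_{x_i}f_i$ is the convex subdifferential with respect to the own strategy. The game mapping is $F:\mathbb R^n\rightrightarrows\mathbb R^n$, $F(x)=\operatorname{col}((\partial_{x_i}f_i(x_i,x_{-i}))_{i\in\mathcal I})$; when $F$ is single-valued, $\partial_{x_i}f_i=\nabla_{x_i}f_i$. For $\boldsymbol x=\operatorname{col}((\boldsymbol x_i)_{i\in\mathcal I})\in\mathbb R^{Nn}$ with $\boldsymbol x_i=\operatorname{col}((\boldsymbol x_{i,j})_{j\in\mathcal I})\in\mathbb R^n$, $\boldsymbol x_{i,j}\in\mathbb R^{n_j}$, $\boldsymbol x_{i,i}=x_i$, $\boldsymbol x_{i,-i}=\operatorname{col}((\boldsymbol x_{i,j})_{j\neq i})$, the extended game mapping is $\boldsymbol F(\boldsymbol x)=\operatorname{col}((\partial_{x_i}f_i(x_i,\boldsymbol x_{i,-i}))_{i\in\mathcal I})$. $\mathcal R_i\in\mathbb R^{n_i\times n}$ selects the $i$-th block of a vector in $\mathbb R^n$; $\mathcal R=\operatorname{diag}((\mathcal R_i)_{i})\in\mathbb R^{n\times Nn}$. With $\boldsymbol W=W\otimes I_n$ and $\boldsymbol{\mathcal X}=\{\boldsymbol x\in\mathbb R^{Nn}\mid\mathcal R\boldsymbol x\in\mathcal X\}$, $$\mathcal A_\alpha(\boldsymbol x)=\alpha\mathcal R^\top\boldsymbol F(\boldsymbol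 x)+(I_{Nn}-\boldsymbol W)\boldsymbol x+\mathrm N_{\boldsymbol{\mathcal X}}(\boldsymbol x),$$ with $\mathrm N$ the normal cone (empty outside the set), and $\operatorname{zer}(\mathcal A_\alpha)=\{\boldsymbol x\mid0\in\mathcal A_\alpha(\boldsymbol x)\}$. A known fact: $\operatorname{zer}(\mathcal A_\alpha)=\{\boldsymbol 1_N\otimes x^\star\mid x^\star\text{ is a Nash equilibrium}\}$. Restricted monotonicity. $\mathcal F:\mathbb R^q\rightrightarrows\mathbb R^q$ is restricted monotone with respect to $\Sigma\ne\varnothing$ if $\langle x-x^\star,u-u^\star\rangle\ge0$ for all $(x,u),(x^\star,u^\star)$ in the graph of $\mathcal F$ with $x^\star\in\Sigma$. *)

theory Defs
  imports "HOL-Analysis.Analysis"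
begin

(* The coordinates of R^n are indexed by the finite type 'k, the agents by the finite type 'i, and
   own k is the agent to which coordinate k belongs.  The space R^(n_i) of agent i is represented by
   the vectors of R^n supported on the coordinates of i, and R^(Nn) by real^'k^'i, where
   X $ i is the i-th copy of R^n (agent i's estimate of the whole profile). *)

definition block :: "('k \<Rightarrow> 'i) \<Rightarrow> 'i \<Rightarrow> real^'k \<Rightarrow> real^'k" where
  "block own i x = (\<chi> k. if own k = i then x $ k else 0)"

definition block_space :: "('k \<Rightarrow> 'i) \<Rightarrow> 'i \<Rightarrow> (real^'k) set" where
  "block_space own i = {y. \<forall>k. own k \<noteq> i \<longrightarrow> y $ k = 0}"

(* The profile (y_i, x_{-i}). *)
definition combine :: "('k \<Rightarrow> 'i) \<Rightarrow> 'i \<Rightarrow> real^'k \<Rightarrow> real^'k \<Rightarrow> real^'k" where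
  "combine own i y x = (\<chi> k. if own k = i then y $ k else x $ k)"

(* The function f_i( . , x_{-i}), extended from R^(n_i) to R^n by ignoring the coordinates of the
   other agents.  Its convexity is that of f_i( . , x_{-i}), and its subgradients and its gradient
   are those of f_i( . , x_{-i}), extended by zero: see own_subdifferential_block. *)
definition own_cost ::
    "('k \<Rightarrow> 'i) \<Rightarrow> ('i \<Rightarrow> real^'k \<Rightarrow> real) \<Rightarrow> 'i \<Rightarrow> real^'k \<Rightarrow> real^'k \<Rightarrow> real" where
  "own_cost own f i x = (\<lambda>y. f i (combine own i y x))"

definition profiles :: "('k \<Rightarrow> 'i) \<Rightarrow> ('i \<Rightarrow> (real^'k) set) \<Rightarrow> (real^'k) set" where
  "profiles own X = {x. \<forall>i. block own i x \<in> X i}"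

definition nash_equilibrium ::
    "('k \<Rightarrow> 'i) \<Rightarrow> ('i \<Rightarrow> (real^'k) set) \<Rightarrow> ('i \<Rightarrow> real^'k \<Rightarrow> real) \<Rightarrow> real^'k \<Rightarrow> bool" where
  "nash_equilibrium own X f x \<longleftrightarrow>
     x \<in> profiles own X \<and>
     (\<forall>i. is_arg_min (own_cost own f i x) (\<lambda>y. y \<in> X i) (block own i x))"

definition subdifferential :: "('a::real_inner \<Rightarrow> real) \<Rightarrow> 'a \<Rightarrow> 'a set" where
  "subdifferential g x = {u. \<forall>y. g y \<ge> g x + u \<bullet> (y - x)}"

definition normal_cone :: "'a::real_inner set \<Rightarrow> 'a \<Rightarrow> 'a set" where
  "normal_cone S x = (if x \<in> S then {v. \<forall>y\<in>S. v \<bullet> (y - x) \<le> 0} else {})"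

definition own_subdifferential ::
    "('k::finite \<Rightarrow> 'i) \<Rightarrow> ('i \<Rightarrow> real^'k \<Rightarrow> real) \<Rightarrow> 'i \<Rightarrow> real^'k \<Rightarrow> (real^'k) set" where
  "own_subdifferential own f i x = subdifferential (own_cost own f i x) (block own i x)"

definition game_mapping ::
    "('k::finite \<Rightarrow> 'i) \<Rightarrow> ('i \<Rightarrow> real^'k \<Rightarrow> real) \<Rightarrow> real^'k \<Rightarrow> (real^'k) set" where
  "game_mapping own f x = {u. \<forall>i. block own i u \<in> own_subdifferential own f i x}"

(* Agent i evaluates its subdifferential at its own copy X $ i, whose i-th block is its strategy. *)
definition extended_game_mapping ::
    "('k::finite \<Rightarrow> 'i::finite) \<Rightarrow> ('i \<Rightarrow> real^'k \<Rightarrow> real) \<Rightarrow> real^'k^'i \<Rightarrow> (real^'k) set" where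
  "extended_game_mapping own f X = {u. \<forall>i. block own i u \<in> own_subdifferential own f i (X $ i)}"

(* The matrix diag(R_1, ..., R_N) as a linear map; its transpose is the adjoint map. *)
definition selection :: "('k \<Rightarrow> 'i) \<Rightarrow> real^'k^'i \<Rightarrow> real^'k" where
  "selection own X = (\<chi> k. X $ own k $ k)"

(* The Kronecker product of W with the identity of R^n. *)
definition kron_id :: "real^'i^'i \<Rightarrow> real^'k^'i \<Rightarrow> real^'k^'i" where
  "kron_id W X = (\<chi> i. \<Sum>j\<in>UNIV. W $ i $ j *\<^sub>R X $ j)"

definition extended_feasible ::
    "('k \<Rightarrow> 'i) \<Rightarrow> ('i \<Rightarrow> (real^'k) set) \<Rightarrow> (real^'k^'i) set" where
  "extended_feasible own S = {X. selection own X \<in> profiles own S}"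

definition selected_extended_mapping ::
    "('k::finite \<Rightarrow> 'i::finite) \<Rightarrow> ('i \<Rightarrow> real^'k \<Rightarrow> real) \<Rightarrow> real^'k^'i \<Rightarrow> (real^'k^'i) set" where
  "selected_extended_mapping own f X = adjoint (selection own) ` extended_game_mapping own f X"

definition equilibrium_operator ::
    "('k::finite \<Rightarrow> 'i::finite) \<Rightarrow> ('i \<Rightarrow> (real^'k) set) \<Rightarrow> ('i \<Rightarrow> real^'k \<Rightarrow> real) \<Rightarrow>
     real^'i^'i \<Rightarrow> real \<Rightarrow> real^'k^'i \<Rightarrow> (real^'k^'i) set" where
  "equilibrium_operator own S f W \<alpha> X =
     {\<alpha> *\<^sub>R u + (X - kron_id W X) + v | u v.
        u \<in> selected_extended_mapping own f X \<and> v \<in> normal_cone (extended_feasible own S) X}"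

definition zer :: "('a \<Rightarrow> 'b::zero set) \<Rightarrow> 'a set" where
  "zer A = {x. 0 \<in> A x}"

definition restricted_monotone :: "('a::real_inner \<Rightarrow> 'a set) \<Rightarrow> 'a set \<Rightarrow> bool" where
  "restricted_monotone A S \<longleftrightarrow>
     S \<noteq> {} \<and>
     (\<forall>x u x' u'. u \<in> A x \<longrightarrow> x' \<in> S \<longrightarrow> u' \<in> A x' \<longrightarrow> (x - x') \<bullet> (u - u') \<ge> 0)"

definition weighted_connected_graph :: "('i::finite \<times> 'i) set \<Rightarrow> real^'i^'i \<Rightarrow> bool" where
  "weighted_connected_graph E W \<longleftrightarrow>
     sym E \<and> (\<forall>i j. (i, j) \<in> E\<^sup>*) \<and>
     (\<forall>i j. i \<noteq> j \<longrightarrow> (if (i, j) \<in> E then W $ i $ j > 0 else W $ i $ j = 0)) \<and>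
     transpose W = W \<and> (\<forall>i. W $ i $ i > 0) \<and> W *v 1 = 1 \<and> 1 v* W = 1"

lemma own_subdifferential_block:
  assumes "u \<in> own_subdifferential own f i x"
  shows "u \<in> block_space own i"
proof -
  have "u $ k = 0" if k: "own k \<noteq> i" for k
  proof -
    have *: "own_cost own f i x y \<ge> own_cost own f i x (block own i x) + u \<bullet> (y - block own i x)"
      for y
      using assms by (simp add: own_subdifferential_def subdifferential_def)
    have same: "own_cost own f i x (block own i x + c *\<^sub>R axis k 1)
                = own_cost own f i x (block own i x)" for c
    proof -
      have "combine own i (block own i x + c *\<^sub>R axis k 1) x = combine own i (block own i x) x"
        using k by (auto simp: combine_def vec_eq_iff axis_def)
      then show ?thesis by (simp add: own_cost_def)
    qed
    have "c * u $ k \<le> 0" for c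
      using *[of "block own i x + c *\<^sub>R axis k 1"] same[of c]
      by (simp add: inner_axis)
    from this[of 1] this[of "-1"] show ?thesis by simp
  qed
  then show ?thesis by (auto simp: block_space_def)
qed

lemma linear_selection: "linear (selection own)"
  by (rule linearI) (auto simp: selection_def vec_eq_iff)

lemma adjoint_selection:
  fixes own :: "'k::finite \<Rightarrow> 'i::finite"
  shows "adjoint (selection own) = (\<lambda>u. \<chi> i. block own i u)"
proof (rule adjoint_unique, intro allI)
  fix X :: "real^'k^'i" and u :: "real^'k"
  have "X \<bullet> (\<chi> i. block own i u) = (\<Sum>i\<in>UNIV. \<Sum>k\<in>UNIV. if own k = i then X $ i $ k * u $ k else 0)"
    by (auto simp: inner_vec_def block_def intro!: sum.cong)
  also have "\<dots> = (\<Sum>k\<in>UNIV. \<Sum>i\<in>UNIV. if own k = i then X $ i $ k * u $ k else 0)"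
    by (rule sum.swap)
  also have "\<dots> = selection own X \<bullet> u"
    by (simp add: inner_vec_def selection_def)
  finally show "selection own X \<bullet> u = X \<bullet> (\<chi> i. block own i u)" by simp
qed

end

theory Submission
  imports Defs
begin

text \<open>Single-valuedness and continuity of the game mapping make every own cost differentiable, with
  gradient the own block of the game mapping.  A stack of estimates that is a zero of the operator is a
  consensus: summing the inclusion over the agents eliminates the Laplacian term, which must
  therefore vanish on its own.  Hence the zeros are the copies of Nash equilibria.  If the own
  gradients at an equilibrium do not depend on the other agents, restricted monotonicity is
  monotonicity of the convex subdifferential, agent by agent.  Conversely, perturb the estimate of
  one agent only, by a step \<open>t *\<^sub>R d\<close> in its own strategy and an arbitrary change of the other
  strategies: dividing by \<open>t\<close> and letting \<open>t\<close> tend to zero shows that the change of the own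
  gradient has nonnegative inner product with every \<open>d\<close>.\<close>

section \<open>Subgradients, differentiability and first-order optimality\<close>

lemma nonneg_at_right_limit:
  fixes h :: "real \<Rightarrow> real"
  assumes "isCont h 0" and "\<And>t. 0 < t \<Longrightarrow> t < 1 \<Longrightarrow> h t \<ge> 0"
  shows "h 0 \<ge> 0"
proof (rule tendsto_lowerbound)
  show "(h \<longlongrightarrow> h 0) (at_right 0)"
    using assms(1) by (simp add: isCont_def filterlim_at_split)
  show "\<forall>\<^sub>F t in at_right 0. 0 \<le> h t"
    by (rule eventually_at_rightI[of 0 1]) (use assms(2) in auto)
qed simp

lemma subdifferential_monotone:
  assumes "u \<in> subdifferential g x" and "v \<in> subdifferential g y"
  shows "(x - y) \<bullet> (u - v) \<ge> 0"
proof -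
  have "g y \<ge> g x + u \<bullet> (y - x)" "g x \<ge> g y + v \<bullet> (x - y)"
    using assms by (auto simp: subdifferential_def)
  then show ?thesis by (simp add: algebra_simps inner_commute)
qed

lemma GDERIV_unique:
  assumes "GDERIV g x :> u" and "GDERIV g x :> v"
  shows "u = v"
proof -
  have "(\<lambda>h. h \<bullet> u) = (\<lambda>h. h \<bullet> v)"
    using assms unfolding gderiv_def by (rule has_derivative_unique)
  then show ?thesis by (metis inner_commute vector_eq_rdot)
qed

text \<open>The subgradient inequality at \<open>x\<close> bounds the first-order remainder below by
  0, and the one at \<open>x + h\<close> bounds it above by
  \<open>(s (x + h) - s x) \<bullet> h\<close>. Divided by \<open>norm h\<close>, it is at most
  \<open>norm (s (x + h) - s x)\<close>, which vanishes in the limit by continuity of the selection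
  \<open>s\<close>.\<close>

lemma GDERIV_continuous_subgradient:
  fixes g :: "'a::real_inner \<Rightarrow> real"
  assumes s: "\<And>y. s y \<in> subdifferential g y" and cont: "isCont s x"
  shows "GDERIV g x :> s x"
proof -
  have sub: "g z \<ge> g y + s y \<bullet> (z - y)" for y z
    using s[of y] by (simp add: subdifferential_def)
  have bound: "norm (norm (g (x + h) - g x - h \<bullet> s x) / norm h) \<le> norm (s (x + h) - s x)" for h
  proof (cases "h = 0")
    case False
    have "0 \<le> g (x + h) - g x - h \<bullet> s x"
      using sub[of x "x + h"] by (simp add: inner_commute)
    moreover have "g (x + h) - g x - h \<bullet> s x \<le> (s (x + h) - s x) \<bullet> h"
      using sub[of "x + h" x] by (simp add: inner_commute inner_diff_right)
    moreover have "\<dots> \<le> norm (s (x + h) - s x) * norm h"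
      by (rule norm_cauchy_schwarz)
    ultimately show ?thesis using False by (simp add: divide_le_eq)
  qed simp
  have "((\<lambda>h. s (x + h) - s x) \<longlongrightarrow> 0) (at 0)"
    using cont by (simp add: isCont_iff LIM_zero_iff)
  then have "((\<lambda>h. norm (g (x + h) - g x - h \<bullet> s x) / norm h) \<longlongrightarrow> 0) (at 0)"
    by (rule tendsto_0_le[where K = 1]) (use bound in auto)
  then show ?thesis
    by (simp add: gderiv_def has_derivative_at bounded_linear_inner_left)
qed

text \<open>Minimality is compared with the subgradient at an intermediate point \<open>z\<close> of
  the segment from \<open>x\<close> to \<open>y\<close>: evaluated back at \<open>x\<close>, it
  forces \<open>s z \<bullet> (y - x)\<close> to be nonnegative. Continuity of \<open>s\<close>
  carries the sign to \<open>x\<close>.\<close>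

lemma subgradient_first_order_condition:
  fixes g :: "'a::real_inner \<Rightarrow> real"
  assumes s: "\<And>z. s z \<in> subdifferential g z" and cont: "isCont s x"
    and "convex C" "x \<in> C" "y \<in> C" and min: "\<And>z. z \<in> C \<Longrightarrow> g x \<le> g z"
  shows "s x \<bullet> (y - x) \<ge> 0"
proof -
  define h where "h = (\<lambda>t. s (x + t *\<^sub>R (y - x)) \<bullet> (y - x))"
  have "isCont (\<lambda>t::real. x + t *\<^sub>R (y - x)) 0" by (intro continuous_intros)
  then have "isCont (\<lambda>t. s (x + t *\<^sub>R (y - x))) 0"
    by (rule isCont_o2) (simp add: cont)
  then have "isCont h 0" unfolding h_def by (intro continuous_intros)
  moreover have "h t \<ge> 0" if t: "0 < t" "t < 1" for t
  proof -
    let ?z = "x + t *\<^sub>R (y - x)"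
    have "?z = (1 - t) *\<^sub>R x + t *\<^sub>R y" by (simp add: algebra_simps)
    then have "?z \<in> C" using assms(3-5) t by (simp add: convexD)
    then have "g x \<le> g ?z" by (rule min)
    moreover have "g x \<ge> g ?z + s ?z \<bullet> (x - ?z)"
      using s[of ?z] unfolding subdifferential_def by blast
    moreover have "s ?z \<bullet> (x - ?z) = - (t * h t)" by (simp add: h_def)
    ultimately have "0 \<le> t * h t" by linarith
    then show ?thesis using t by (simp add: zero_le_mult_iff)
  qed
  ultimately have "h 0 \<ge> 0" by (rule nonneg_at_right_limit)
  then show ?thesis by (simp add: h_def)
qed

section \<open>Algebra of blocks, combined profiles and the selection map\<close>

lemma block_combine:
  "block own j (combine own i y x) = (if j = i then block own i y else block own j x)"
  by (auto simp: block_def combine_def vec_eq_iff)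

lemma block_of_block_space: "u \<in> block_space own i \<Longrightarrow> block own i u = u"
  by (auto simp: block_def block_space_def vec_eq_iff)

lemma vec_eq_iff_blocks: "u = v \<longleftrightarrow> (\<forall>i. block own i u = block own i v)"
  by (auto simp: block_def vec_eq_iff split: if_splits)

lemma linear_block: "linear (block own i)"
  by (rule linearI) (auto simp: block_def vec_eq_iff)

lemma inner_block: "block own i u \<bullet> block own i v = block own i u \<bullet> v"
  by (auto simp: inner_vec_def block_def intro!: sum.cong)

lemma combine_combine: "combine own i z (combine own i y x) = combine own i z x"
  by (auto simp: combine_def vec_eq_iff)

lemma combine_self: "combine own i x x = x"
  by (auto simp: combine_def vec_eq_iff)

lemma combine_block: "combine own i (block own i y) x = combine own i y x"
  by (auto simp: combine_def block_def vec_eq_iff)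

lemma own_cost_combine: "own_cost own f i (combine own i y x) = own_cost own f i x"
  by (simp add: own_cost_def combine_combine)

lemma own_cost_block: "own_cost own f i x (block own i y) = own_cost own f i x y"
  by (simp add: own_cost_def combine_block)

lemma continuous_on_combine: "continuous_on UNIV (\<lambda>y. combine own i y x)"
  unfolding combine_def
proof (intro continuous_on_vec_lambda)
  show "continuous_on UNIV (\<lambda>y. if own k = i then y $ k else x $ k)" for k
    by (cases "own k = i") (auto intro!: continuous_intros)
qed

lemma inner_adjoint_selection:
  fixes own :: "'k::finite \<Rightarrow> 'i::finite"
  shows "adjoint (selection own) u \<bullet> X = u \<bullet> selection own X"
  by (metis adjoint_works inner_commute linear_selection)

lemma selection_const: "selection own (\<chi> i. x) = x"
  by (simp add: selection_def vec_eq_iff)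

lemma sum_block:
  fixes own :: "'k::finite \<Rightarrow> 'i::finite"
  shows "(\<Sum>i\<in>UNIV. block own i u) = u"
  by (simp add: vec_eq_iff block_def)

text \<open>Feasibility only restricts what \<open>selection\<close> sees. In copy \<open>i\<close>,
  a coordinate owned by another agent can be moved freely in both directions, so a normal vector
  vanishes there.\<close>

lemma normal_cone_extended_feasible:
  fixes own :: "'k::finite \<Rightarrow> 'i::finite"
  assumes "v \<in> normal_cone (extended_feasible own S) X"
  shows "v $ i \<in> block_space own i"
proof -
  have "v $ i $ k = 0" if k: "own k \<noteq> i" for k
  proof -
    have feasible: "X \<in> extended_feasible own S"
      and v: "\<And>Y. Y \<in> extended_feasible own S \<Longrightarrow> v \<bullet> (Y - X) \<le> 0"
      using assms by (auto simp: normal_cone_def split: if_splits)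
    have "selection own (X + axis i (axis k c)) = selection own X" for c
      using k by (auto simp: selection_def vec_eq_iff axis_def)
    then have "X + axis i (axis k c) \<in> extended_feasible own S" for c
      using feasible by (simp add: extended_feasible_def)
    from v[OF this] have "v $ i $ k * c \<le> 0" for c
      by (simp add: inner_axis)
    from this[of 1] this[of "-1"] show ?thesis by simp
  qed
  then show ?thesis by (auto simp: block_space_def)
qed

section \<open>The weighted graph: Laplacian energy and consensus\<close>

lemma weight_row_sum: "weighted_connected_graph E W \<Longrightarrow> (\<Sum>j\<in>UNIV. W $ i $ j) = 1"
  by (auto simp: weighted_connected_graph_def matrix_vector_mult_def vec_eq_iff)

lemma weight_sym: "weighted_connected_graph E W \<Longrightarrow> W $ i $ j = W $ j $ i"
  by (auto simp: weighted_connected_graph_def transpose_def vec_eq_iff)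

lemma kron_id_const:
  assumes "weighted_connected_graph E W"
  shows "kron_id W (\<chi> i. x) = (\<chi> i. x)"
  by (simp add: kron_id_def weight_row_sum[OF assms] flip: scaleR_sum_left)

lemma sum_kron_id:
  assumes "weighted_connected_graph E W"
  shows "(\<Sum>i\<in>UNIV. kron_id W X $ i) = (\<Sum>i\<in>UNIV. X $ i)"
proof -
  have "(\<Sum>i\<in>UNIV. kron_id W X $ i) = (\<Sum>j\<in>UNIV. \<Sum>i\<in>UNIV. W $ i $ j *\<^sub>R X $ j)"
    by (simp add: kron_id_def) (rule sum.swap)
  also have "\<dots> = (\<Sum>j\<in>UNIV. (\<Sum>i\<in>UNIV. W $ j $ i) *\<^sub>R X $ j)"
    unfolding scaleR_sum_left
    by (intro sum.cong refl arg_cong2[where f = scaleR] weight_sym[OF assms])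
  finally show ?thesis by (simp add: weight_row_sum[OF assms])
qed

text \<open>Expanding the square leaves two diagonal sums and a cross term. As the rows and, by
  symmetry, the columns of \<open>W\<close> sum to one, each diagonal sum is
  \<open>X \<bullet> X\<close>.\<close>

lemma laplacian_energy:
  fixes X :: "real^'k^'i"
  assumes "weighted_connected_graph E W"
  shows "(\<Sum>i\<in>UNIV. \<Sum>j\<in>UNIV. W $ i $ j * (norm (X $ i - X $ j))\<^sup>2) = 2 * (X \<bullet> (X - kron_id W X))"
proof -
  have inner: "X \<bullet> kron_id W X = (\<Sum>i\<in>UNIV. \<Sum>j\<in>UNIV. W $ i $ j * (X $ i \<bullet> X $ j))"
    by (simp add: inner_vec_def[of X] kron_id_def inner_sum_right)
  have rows: "(\<Sum>i\<in>UNIV. \<Sum>j\<in>UNIV. W $ i $ j * (X $ i \<bullet> X $ i)) = X \<bullet> X"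
    by (simp add: inner_vec_def[of X] weight_row_sum[OF assms] flip: sum_distrib_right)
  have "(\<Sum>i\<in>UNIV. \<Sum>j\<in>UNIV. W $ i $ j * (X $ j \<bullet> X $ j)) =
      (\<Sum>j\<in>UNIV. \<Sum>i\<in>UNIV. W $ i $ j * (X $ j \<bullet> X $ j))"
    by (rule sum.swap)
  also have "\<dots> = (\<Sum>j\<in>UNIV. \<Sum>i\<in>UNIV. W $ j $ i * (X $ j \<bullet> X $ j))"
    by (intro sum.cong refl arg_cong2[where f = times] weight_sym[OF assms])
  finally have cols: "(\<Sum>i\<in>UNIV. \<Sum>j\<in>UNIV. W $ i $ j * (X $ j \<bullet> X $ j)) = X \<bullet> X"
    by (simp add: rows)
  have "W $ i $ j * (norm (X $ i - X $ j))\<^sup>2 =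
      W $ i $ j * (X $ i \<bullet> X $ i) + W $ i $ j * (X $ j \<bullet> X $ j) - 2 * (W $ i $ j * (X $ i \<bullet> X $ j))"
    for i j
    unfolding power2_norm_eq_inner by (simp add: algebra_simps inner_commute)
  then show ?thesis
    by (simp add: sum.distrib sum_subtractf inner rows cols inner_diff_right flip: sum_distrib_left)
qed

text \<open>The energy of a fixed point is 0 and its terms are nonnegative, so the copies agree
  across every edge, where the weight is positive. Connectivity propagates the agreement along
  paths.\<close>

lemma kron_id_fixed_consensus:
  fixes X :: "real^'k^'i"
  assumes graph: "weighted_connected_graph E W" and fixed: "kron_id W X = X"
  shows "X $ i = X $ j"
proof -
  have nonneg: "W $ i $ j \<ge> 0" for i j
    using graph unfolding weighted_connected_graph_def by (metis less_eq_real_def)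
  have "(\<Sum>i\<in>UNIV. \<Sum>j\<in>UNIV. W $ i $ j * (norm (X $ i - X $ j))\<^sup>2) = 0"
    using laplacian_energy[OF graph, of X] fixed by simp
  then have zero: "W $ i $ j * (norm (X $ i - X $ j))\<^sup>2 = 0" for i j
    by (simp add: sum_nonneg_eq_0_iff sum_nonneg nonneg)
  have edge: "X $ i = X $ j" if "(i, j) \<in> E" for i j
  proof (cases "i = j")
    case False
    then have "W $ i $ j > 0"
      using graph that unfolding weighted_connected_graph_def by metis
    then show ?thesis using zero[of i j] by simp
  qed simp
  have "(i, j) \<in> E\<^sup>*" using graph by (simp add: weighted_connected_graph_def)
  then show ?thesis by (induction rule: rtrancl_induct) (simp_all add: edge)
qed

section \<open>Own gradients from a single-valued game mapping\<close>

text \<open>The game mapping is a product over the agents: splicing another own subgradient into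
  block \<open>i\<close> of \<open>G x\<close> gives again an element of it, so single-valuedness
  passes to each factor.\<close>

lemma own_subdifferential_single_valued:
  assumes G: "\<And>x. game_mapping own f x = {G x}"
  shows "own_subdifferential own f i x = {block own i (G x)}"
proof -
  have mem: "block own j (G x) \<in> own_subdifferential own f j x" for j
  proof -
    have "G x \<in> game_mapping own f x" by (simp add: G)
    then show ?thesis by (simp add: game_mapping_def)
  qed
  have "u = block own i (G x)" if u: "u \<in> own_subdifferential own f i x" for u
  proof -
    have bu: "block own i u = u"
      using own_subdifferential_block[OF u] by (rule block_of_block_space)
    then have "combine own i u (G x) \<in> game_mapping own f x"
      using u mem by (simp add: game_mapping_def block_combine)
    then have "combine own i u (G x) = G x" using G by simp
    then have "block own i (G x) = block own i u"
      using block_combine[of own i i u "G x"] by simp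
    then show ?thesis using bu by simp
  qed
  then show ?thesis using mem[of i] by blast
qed

text \<open>The definition provides the subgradient at \<open>block own i y\<close> only. It extends
  to every \<open>y\<close> because neither the own cost nor the inner product with a vector
  supported on block \<open>i\<close> sees the other coordinates. With \<open>x\<close> frozen, this
  is a selection on the whole space, as the differentiability and first-order lemmas
  require.\<close>

lemma own_cost_subgradient:
  assumes G: "\<And>x. game_mapping own f x = {G x}"
  shows "block own i (G (combine own i y x)) \<in> subdifferential (own_cost own f i x) y"
proof -
  let ?u = "block own i (G (combine own i y x))"
  have "?u \<in> own_subdifferential own f i (combine own i y x)"
    by (simp add: own_subdifferential_single_valued[OF G])
  then have "?u \<in> subdifferential (own_cost own f i x) (block own i y)"
    by (simp add: own_subdifferential_def own_cost_combine block_combine)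
  moreover have "?u \<bullet> block own i y = ?u \<bullet> y" by (rule inner_block)
  ultimately show ?thesis
    by (simp add: subdifferential_def own_cost_block inner_diff_right)
qed

lemma continuous_own_gradient:
  fixes G :: "real^'k \<Rightarrow> real^'k"
  assumes "continuous_on UNIV G"
  shows "isCont (\<lambda>y. block own i (G (combine own i y x))) y"
proof -
  have "continuous_on UNIV (\<lambda>y. G (combine own i y x))"
    by (rule continuous_on_compose2[OF assms continuous_on_combine]) simp
  then have "continuous_on UNIV (\<lambda>y. block own i (G (combine own i y x)))"
    by (rule linear_continuous_on_compose[OF _ linear_block])
  then show ?thesis by (simp add: continuous_on_eq_continuous_at)
qed

lemma own_cost_gradient:
  assumes "\<And>x. game_mapping own f x = {G x}" and "continuous_on UNIV G"
  shows "GDERIV (own_cost own f i x) (block own i y) :> block own i (G (combine own i y x))"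
  using GDERIV_continuous_subgradient[OF own_cost_subgradient[OF assms(1)]
      continuous_own_gradient[OF assms(2)], of i x "block own i y"]
  by (simp add: combine_block)

section \<open>Nash equilibria as solutions of a variational inequality\<close>

text \<open>The first-order conditions of the agents' separate minimizations are added up; the
  blocks of \<open>G x\<close> sum to \<open>G x\<close>.\<close>

lemma nash_variational_inequality:
  fixes own :: "'k::finite \<Rightarrow> 'i::finite"
  assumes strategies: "\<And>i. convex (S i)"
    and G: "\<And>x. game_mapping own f x = {G x}" "continuous_on UNIV G"
    and nash: "nash_equilibrium own S f x" and y: "y \<in> profiles own S"
  shows "G x \<bullet> (y - x) \<ge> 0"
proof -
  have "block own i (G x) \<bullet> (y - x) \<ge> 0" for i
  proof -
    have "block own i (G (combine own i (block own i x) x)) \<bullet> (block own i y - block own i x) \<ge> 0"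
    proof (rule subgradient_first_order_condition[OF own_cost_subgradient[OF G(1)]
          continuous_own_gradient[OF G(2)] strategies])
      show "block own i x \<in> S i" "block own i y \<in> S i"
        using nash y by (auto simp: nash_equilibrium_def profiles_def)
      show "own_cost own f i x (block own i x) \<le> own_cost own f i x z" if "z \<in> S i" for z
        using nash that by (auto simp: nash_equilibrium_def is_arg_min_linorder)
    qed
    then show ?thesis
      by (simp add: combine_block combine_self inner_block inner_diff_right)
  qed
  then have "(\<Sum>i\<in>UNIV. block own i (G x)) \<bullet> (y - x) \<ge> 0"
    by (simp add: inner_sum_left sum_nonneg)
  then show ?thesis by (simp add: sum_block)
qed

text \<open>Testing the inequality with a deviation of agent \<open>i\<close> alone isolates block
  \<open>i\<close> of \<open>u\<close>, and the subgradient inequality then shows that the deviation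
  does not lower the cost.\<close>

lemma variational_inequality_nash:
  assumes strategies: "\<And>i. S i \<subseteq> block_space own i"
    and u: "u \<in> game_mapping own f x" and x: "x \<in> profiles own S"
    and vi: "\<And>y. y \<in> profiles own S \<Longrightarrow> u \<bullet> (y - x) \<ge> 0"
  shows "nash_equilibrium own S f x"
proof -
  have "own_cost own f i x (block own i x) \<le> own_cost own f i x y" if y: "y \<in> S i" for i y
  proof -
    have y_block: "block own i y = y" using strategies y by (blast intro: block_of_block_space)
    have "combine own i y x \<in> profiles own S"
      using x y by (auto simp: profiles_def block_combine y_block)
    then have "u \<bullet> (combine own i y x - x) \<ge> 0" by (rule vi)
    moreover have "combine own i y x - x = block own i (y - x)"
      by (auto simp: combine_def block_def vec_eq_iff)
    moreover have "u \<bullet> block own i (y - x) = block own i u \<bullet> (y - block own i x)"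
    proof -
      have "block own i (y - x) = y - block own i x"
        by (simp only: linear_diff[OF linear_block] y_block)
      moreover have "u \<bullet> block own i (y - x) = block own i u \<bullet> block own i (y - x)"
        using inner_block[of own i "y - x" u] by (simp add: inner_commute)
      ultimately show ?thesis by simp
    qed
    moreover have "block own i u \<in> subdifferential (own_cost own f i x) (block own i x)"
      using u by (simp add: game_mapping_def own_subdifferential_def)
    then have "own_cost own f i x y \<ge>
        own_cost own f i x (block own i x) + block own i u \<bullet> (y - block own i x)"
      by (simp add: subdifferential_def)
    ultimately show ?thesis by simp
  qed
  then show ?thesis
    using x by (auto simp: nash_equilibrium_def is_arg_min_linorder profiles_def)
qed

section \<open>Zeros of the equilibrium operator\<close>

text \<open>Summation over the agents cancels the Laplacian term and leaves
  \<open>\<alpha> *\<^sub>R u + selection own v = 0\<close>. Each \<open>v $ i\<close> is supported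
  on block \<open>i\<close>, so its selection determines \<open>v\<close> completely; substituting
  \<open>v\<close> back makes the Laplacian term vanish.\<close>

lemma equilibrium_operator_zero_split:
  fixes own :: "'k::finite \<Rightarrow> 'i::finite"
  assumes graph: "weighted_connected_graph E W"
    and v: "v \<in> normal_cone (extended_feasible own S) X"
    and zero: "\<alpha> *\<^sub>R adjoint (selection own) u + (X - kron_id W X) + v = 0"
  shows "kron_id W X = X" and "v = - \<alpha> *\<^sub>R adjoint (selection own) u"
proof -
  have zero_i: "\<alpha> *\<^sub>R block own i u + (X $ i - kron_id W X $ i) + v $ i = 0" for i
    using arg_cong[OF zero, of "\<lambda>Z. Z $ i"] by (simp add: adjoint_selection)
  have "(\<Sum>i\<in>UNIV. \<alpha> *\<^sub>R block own i u + (X $ i - kron_id W X $ i) + v $ i) = 0"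
    using zero_i by simp
  then have "\<alpha> *\<^sub>R u + (\<Sum>i\<in>UNIV. v $ i) = 0"
    by (simp add: sum.distrib sum_subtractf sum_kron_id[OF graph] sum_block
        flip: scaleR_sum_right)
  moreover have "(\<Sum>i\<in>UNIV. v $ i) = selection own v"
  proof -
    have own: "v $ i $ k = (if own k = i then v $ own k $ k else 0)" for i k
      using normal_cone_extended_feasible[OF v, of i] by (auto simp: block_space_def)
    have "(\<Sum>i\<in>UNIV. v $ i $ k) = v $ own k $ k" for k
    proof -
      have "(\<Sum>i\<in>UNIV. v $ i $ k) = (\<Sum>i\<in>UNIV. if own k = i then v $ own k $ k else 0)"
        by (rule sum.cong[OF refl]) (rule own)
      then show ?thesis by simp
    qed
    then show ?thesis by (simp add: vec_eq_iff selection_def)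
  qed
  ultimately have sel: "v $ own k $ k = - \<alpha> * u $ k" for k
    by (simp add: vec_eq_iff selection_def add_eq_0_iff)
  have "v $ i $ k = (- \<alpha> *\<^sub>R block own i u) $ k" for i k
    using sel[of k] normal_cone_extended_feasible[OF v, of i]
    by (auto simp: block_space_def block_def)
  then show v_eq: "v = - \<alpha> *\<^sub>R adjoint (selection own) u"
    by (simp add: vec_eq_iff adjoint_selection)
  show "kron_id W X = X"
    using zero v_eq by simp
qed

lemma zer_equilibrium_operator:
  fixes own :: "'k::finite \<Rightarrow> 'i::finite"
  assumes strategies: "\<And>i. S i \<subseteq> block_space own i \<and> convex (S i)"
    and graph: "weighted_connected_graph E W" and alpha: "\<alpha> > 0"
    and G: "\<And>x. game_mapping own f x = {G x}" "continuous_on UNIV G"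
  shows "zer (equilibrium_operator own S f W \<alpha>) = {\<chi> i. x | x. nash_equilibrium own S f x}"
proof (intro Set.set_eqI iffI)
  fix X assume "X \<in> zer (equilibrium_operator own S f W \<alpha>)"
  then obtain u v where u: "u \<in> extended_game_mapping own f X"
    and v: "v \<in> normal_cone (extended_feasible own S) X"
    and zero: "\<alpha> *\<^sub>R adjoint (selection own) u + (X - kron_id W X) + v = 0"
    by (auto simp: zer_def equilibrium_operator_def selected_extended_mapping_def)
  note split = equilibrium_operator_zero_split[OF graph v zero]
  obtain x where X: "X = (\<chi> i. x)"
    using kron_id_fixed_consensus[OF graph split(1)] by (metis vec_lambda_unique)
  have "nash_equilibrium own S f x"
  proof (rule variational_inequality_nash)
    show "u \<in> game_mapping own f x"
      using u by (simp add: X extended_game_mapping_def game_mapping_def)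
    show "x \<in> profiles own S"
      using v by (auto simp: normal_cone_def extended_feasible_def X selection_const split: if_splits)
    show "u \<bullet> (y - x) \<ge> 0" if "y \<in> profiles own S" for y
    proof -
      \<comment> \<open>The normal cone is tested only at consensus points; the adjoint turns this
        into the inequality for \<open>u\<close>.\<close>
      have "(\<chi> i. y) \<in> extended_feasible own S"
        using that by (simp add: extended_feasible_def selection_const)
      then have "v \<bullet> ((\<chi> i. y) - X) \<le> 0"
        using v by (auto simp: normal_cone_def split: if_splits)
      then have "0 \<le> \<alpha> * (u \<bullet> (y - x))"
        by (simp add: split(2) inner_adjoint_selection linear_diff[OF linear_selection]
            X selection_const)
      then show ?thesis using alpha by (simp add: zero_le_mult_iff)
    qed
  qed (use strategies in blast)
  then show "X \<in> {\<chi> i. x | x. nash_equilibrium own S f x}" using X by blast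
next
  fix X :: "real^'k^'i" assume "X \<in> {\<chi> i. x | x. nash_equilibrium own S f x}"
  then obtain x where X: "X = (\<chi> i. x)" and nash: "nash_equilibrium own S f x" by blast
  \<comment> \<open>At consensus the Laplacian term is zero, so the normal vector must cancel the
    gradient term exactly. The variational inequality at \<open>x\<close> is what puts it in the
    normal cone.\<close>
  define v where "v = - \<alpha> *\<^sub>R adjoint (selection own) (G x)"
  have "G x \<in> game_mapping own f x" using G(1) by simp
  then have "G x \<in> extended_game_mapping own f X"
    by (simp add: X extended_game_mapping_def game_mapping_def)
  moreover have "v \<in> normal_cone (extended_feasible own S) X"
  proof -
    have "X \<in> extended_feasible own S"
      using nash by (simp add: extended_feasible_def X selection_const nash_equilibrium_def)
    moreover have "v \<bullet> (Y - X) \<le> 0" if "Y \<in> extended_feasible own S" for Y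
    proof -
      have "G x \<bullet> (selection own Y - x) \<ge> 0"
        by (rule nash_variational_inequality[OF _ G nash])
          (use strategies that in \<open>auto simp: extended_feasible_def\<close>)
      then show ?thesis
        using alpha by (simp add: v_def inner_adjoint_selection linear_diff[OF linear_selection]
            X selection_const)
    qed
    ultimately show ?thesis by (simp add: normal_cone_def)
  qed
  moreover have "\<alpha> *\<^sub>R adjoint (selection own) (G x) + (X - kron_id W X) + v = 0"
    by (simp add: X kron_id_const[OF graph] v_def)
  ultimately show "X \<in> zer (equilibrium_operator own S f W \<alpha>)"
    unfolding zer_def equilibrium_operator_def selected_extended_mapping_def mem_Collect_eq
    by (metis image_eqI)
qed

section \<open>Restricted monotonicity against independence of the own gradients\<close>

lemma selected_extended_mapping_single_valued:
  fixes own :: "'k::finite \<Rightarrow> 'i::finite"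
  assumes G: "\<And>x. game_mapping own f x = {G x}"
  shows "selected_extended_mapping own f X = {\<chi> i. block own i (G (X $ i))}"
proof -
  \<comment> \<open>The only candidate is glued together: coordinate \<open>k\<close> comes from the
    gradient at the copy held by its owner.\<close>
  have blocks: "block own i (\<chi> k. G (X $ own k) $ k) = block own i (G (X $ i))" for i
    by (auto simp: block_def vec_eq_iff)
  have "extended_game_mapping own f X = {\<chi> k. G (X $ own k) $ k}"
    using vec_eq_iff_blocks[of _ "\<chi> k. G (X $ own k) $ k" own]
    by (auto simp: extended_game_mapping_def own_subdifferential_single_valued[OF G]
        blocks)
  then show ?thesis
    by (simp add: selected_extended_mapping_def adjoint_selection blocks)
qed

lemma restricted_monotone_iff_own_gradients:
  fixes own :: "'k::finite \<Rightarrow> 'i::finite"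
  assumes G: "\<And>x. game_mapping own f x = {G x}" "continuous_on UNIV G" and "P \<noteq> {}"
  shows "restricted_monotone (selected_extended_mapping own f) ((\<lambda>x. \<chi> i. x) ` P) \<longleftrightarrow>
    (\<forall>p\<in>P. \<forall>i x. block own i (G (combine own i p x)) = block own i (G p))"
    (is "?mono \<longleftrightarrow> ?indep")
proof -
  have mono_iff: "?mono \<longleftrightarrow> (\<forall>p\<in>P. \<forall>X :: real^'k^'i.
      (\<Sum>i\<in>UNIV. (X $ i - p) \<bullet> (block own i (G (X $ i)) - block own i (G p))) \<ge> 0)"
    (is "_ \<longleftrightarrow> ?sums")
  proof -
    let ?A = "\<lambda>X :: real^'k^'i. \<chi> i. block own i (G (X $ i))"
    have inner: "(X - Y) \<bullet> (?A X - ?A Y) =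
        (\<Sum>i\<in>UNIV. (X $ i - Y $ i) \<bullet> (block own i (G (X $ i)) - block own i (G (Y $ i))))" for X Y
      by (simp add: inner_vec_def[of "X - Y"])
    have "?mono \<longleftrightarrow> (\<forall>Y\<in>(\<lambda>x. \<chi> i. x) ` P. \<forall>X. (X - Y) \<bullet> (?A X - ?A Y) \<ge> 0)"
      using \<open>P \<noteq> {}\<close>
      unfolding restricted_monotone_def selected_extended_mapping_single_valued[OF G(1)]
      by blast
    also have "\<dots> \<longleftrightarrow> ?sums" unfolding inner by simp
    finally show ?thesis .
  qed
  show ?thesis
  proof
    assume ?mono
    show ?indep
    proof (intro ballI allI)
      fix p i and x :: "real^'k" assume p: "p \<in> P"
      \<comment> \<open>A stack that differs from the consensus at \<open>p\<close> only in copy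
        \<open>i\<close> leaves a single nonzero summand.\<close>
      have single: "(y - p) \<bullet> (block own i (G y) - block own i (G p)) \<ge> 0" for y
      proof -
        have "(\<Sum>j\<in>UNIV. ((\<chi> j. if j = i then y else p) $ j - p) \<bullet>
            (block own j (G ((\<chi> j. if j = i then y else p) $ j)) - block own j (G p))) \<ge> 0"
          using \<open>?mono\<close> p unfolding mono_iff by blast
        also have "(\<Sum>j\<in>UNIV. ((\<chi> j. if j = i then y else p) $ j - p) \<bullet>
            (block own j (G ((\<chi> j. if j = i then y else p) $ j)) - block own j (G p))) =
            (\<Sum>j\<in>UNIV. if j = i then (y - p) \<bullet> (block own i (G y) - block own i (G p)) else 0)"
          by (rule sum.cong) auto
        finally show ?thesis by simp
      qed
      define s where "s y = block own i (G (combine own i y x))" for y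
      \<comment> \<open>The direction is minus the change of own gradient caused by the others
        moving from \<open>p\<close> to \<open>x\<close>. With this choice \<open>h 0\<close> equals
        \<open>- (d \<bullet> d)\<close>, so a nonnegative limit forces
        \<open>d = 0\<close>.\<close>
      define d where "d = block own i (G p) - s p"
      have d_block: "d = block own i (G p - G (combine own i p x))"
        by (simp add: d_def s_def linear_diff[OF linear_block])
      define h where "h t = d \<bullet> (s (p + t *\<^sub>R d) - block own i (G p))" for t
      have "isCont (\<lambda>t::real. p + t *\<^sub>R d) 0" by (intro continuous_intros)
      then have "isCont (\<lambda>t. s (p + t *\<^sub>R d)) 0"
        by (rule isCont_o2) (simp add: s_def continuous_own_gradient[OF G(2)])
      then have "isCont h 0" unfolding h_def by (intro continuous_intros)
      moreover have "h t \<ge> 0" if t: "0 < t" "t < 1" for t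
      proof -
        let ?y = "combine own i (p + t *\<^sub>R d) x"
        let ?D = "G ?y - G p"
        \<comment> \<open>The jump from \<open>p\<close> to \<open>x\<close> in the other blocks is
          not small, but it is invisible to the inner product with a vector of block
          \<open>i\<close>; only the step \<open>t *\<^sub>R d\<close> remains, as \<open>d\<close>
          is supported on that block.\<close>
        have "block own i (?y - p) = t *\<^sub>R d"
          by (auto simp: block_def combine_def vec_eq_iff d_block)
        then have "(?y - p) \<bullet> block own i ?D = t *\<^sub>R d \<bullet> block own i ?D"
          by (metis inner_block inner_commute)
        also have "\<dots> = t * h t"
          by (simp add: h_def s_def linear_diff[OF linear_block])
        finally have "t * h t \<ge> 0"
          using single[of ?y] by (simp add: linear_diff[OF linear_block])
        then show ?thesis using t by (simp add: zero_le_mult_iff)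
      qed
      ultimately have "h 0 \<ge> 0" by (rule nonneg_at_right_limit)
      then have "d \<bullet> d \<le> 0"
        by (simp add: h_def d_def inner_diff_right)
      then have "d = 0" by (metis antisym inner_eq_zero_iff inner_ge_zero)
      then show "block own i (G (combine own i p x)) = block own i (G p)"
        by (simp add: d_def s_def)
    qed
  next
    assume ?indep
    show ?mono
      unfolding mono_iff
    proof (intro ballI allI sum_nonneg)
      fix p i and X :: "real^'k^'i" assume p: "p \<in> P"
      \<comment> \<open>Independence lets the others in \<open>p\<close> be replaced by those in
        \<open>X $ i\<close>, so both vectors become subgradients of one and the same
        function.\<close>
      have "block own i (G (X $ i)) \<in> subdifferential (own_cost own f i (X $ i)) (X $ i)"
        "block own i (G p) \<in> subdifferential (own_cost own f i (X $ i)) p"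
        using own_cost_subgradient[OF G(1), of i "X $ i" "X $ i"]
          own_cost_subgradient[OF G(1), of i p "X $ i"] \<open>?indep\<close> p
        by (simp_all add: combine_self)
      then show "(X $ i - p) \<bullet> (block own i (G (X $ i)) - block own i (G p)) \<ge> 0"
        by (rule subdifferential_monotone)
    qed
  qed
qed

theorem proposition3:
  fixes own :: "'k::finite \<Rightarrow> 'i::finite"
    and S :: "'i \<Rightarrow> (real^'k) set"
    and f :: "'i \<Rightarrow> real^'k \<Rightarrow> real"
    and E :: "('i \<times> 'i) set"
    and W :: "real^'i^'i"
    and \<alpha> :: real
  assumes strategies: "\<And>i. S i \<subseteq> block_space own i \<and> S i \<noteq> {} \<and> closed (S i) \<and> convex (S i)"
    and costs_continuous: "\<And>i. continuous_on UNIV (f i)"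
    and costs_convex: "\<And>i x. convex_on UNIV (own_cost own f i x)"
    and existence: "\<exists>x. nash_equilibrium own S f x"
    and connectivity: "weighted_connected_graph E W"
    and alpha: "\<alpha> > 0"
    and single_valued_continuous:
      "\<exists>G. (\<forall>x. game_mapping own f x = {G x}) \<and> continuous_on UNIV G"
  shows "restricted_monotone (selected_extended_mapping own f)
           (zer (equilibrium_operator own S f W \<alpha>)) \<longleftrightarrow>
         (\<forall>xstar. nash_equilibrium own S f xstar \<longrightarrow>
           (\<forall>i. \<exists>g. \<forall>x. GDERIV (own_cost own f i x) (block own i xstar) :> g))"
proof -
  obtain G where G: "\<And>x. game_mapping own f x = {G x}" "continuous_on UNIV G"
    using single_valued_continuous by auto
  let ?P = "{x. nash_equilibrium own S f x}"
  have zeros: "zer (equilibrium_operator own S f W \<alpha>) = (\<lambda>x. \<chi> i. x) ` ?P"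
    using zer_equilibrium_operator[OF _ connectivity alpha G, of S] strategies by auto
  have gradient: "(\<exists>g. \<forall>x. GDERIV (own_cost own f i x) (block own i p) :> g) \<longleftrightarrow>
      (\<forall>x. block own i (G (combine own i p x)) = block own i (G p))" for i p
  proof
    assume "\<exists>g. \<forall>x. GDERIV (own_cost own f i x) (block own i p) :> g"
    then obtain g where "\<And>x. GDERIV (own_cost own f i x) (block own i p) :> g" by blast
    then have "block own i (G (combine own i p x)) = g" for x
      using own_cost_gradient[OF G, of i x p] by (auto intro: GDERIV_unique)
    \<comment> \<open>Freezing the others at \<open>p\<close> itself identifies the common gradient
      \<open>g\<close> with the own block of \<open>G p\<close>.\<close>
    from this this[of p] show "\<forall>x. block own i (G (combine own i p x)) = block own i (G p)"
      by (simp add: combine_self)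
  next
    assume "\<forall>x. block own i (G (combine own i p x)) = block own i (G p)"
    then show "\<exists>g. \<forall>x. GDERIV (own_cost own f i x) (block own i p) :> g"
      using own_cost_gradient[OF G] by metis
  qed
  have "?P \<noteq> {}" using existence by simp
  from restricted_monotone_iff_own_gradients[OF G this] show ?thesis
    unfolding zeros gradient by simp
qed

end
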